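(* Consider natural gradient flow for the problem of matrix completion. Euclidean gradient flow in the direct parametrization ($\boldsymbol{\beta}=\mathbf{w}$) is equivalent to natural gradient flow under any parametrization $\theta$, $\mathbf{w}=\mathcal{P}(\theta)$, for which the Jacobian $J=\frac{\partial\mathbf{w}_t}{\partial\theta_t}$ is full rank. That is, if $\theta_t$ follows natural gradient flow in the parameters $\theta$ and $J$ is full rank along it, then $\mathbf{w}_t=\mathcal{P}(\theta_t)$ solves $$\dot{\mathbf{w}}_t=-\nabla_{\mathbf{w}}\mathcal{L}(\mathbf{w}_t),$$ which is Euclidean gradient flow in the direct parametrization.
   Context: Matrix completion: recover an unknown matrix $\boldsymbol{\beta}^*\in\mathbb{R}^{D\times D}$ from its entries on an observed index set $\Omega\subseteq\{1,\dots,D\}^2$ by minimizing over $\boldsymbol{\beta}\in\mathbb{R}^{D\times D}$ the squared reconstruction error $\mathcal{L}(\boldsymbol{\beta})=\frac12\sum_{(i,j)\in\Omega}(\boldsymbol{\beta}_{ij}-\boldsymbol{\beta}^*_{ij})^2$. This is the log loss of an isotropic Gaussian observation model with mean $\boldsymbol{\beta}$ and constant noise variance; the variance cancels against the corresponding factor in the log loss, so without loss of generality the Fisher information matrix of $\boldsymbol{\beta}$ is the identity, $F(\boldsymbol{\beta})=I$. The direct parametrization takes the entries of $\boldsymbol{\beta}$ themselves as the parameters $\mathbf{w}$. A parametrization $\theta$ is related to $\mathbf{w}$ by a smooth map $\mathbf{w}=\mathcal{P}(\theta)$ (matrices being identified with vectors in $\mathbb{R}^{D^2}$), with Jacobian $J=\partial\mathbf{w}/\partial\theta$;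 the Fisher information matrix of $\theta$ is $F(\theta)=J^\top F(\boldsymbol{\beta})J=J^\top J$, which need not be invertible. Natural gradient flow in $\theta$ is any trajectory satisfying $F(\theta_t)\dot\theta_t=-\nabla_\theta(\mathcal{L}\circ\mathcal{P})(\theta_t)$.
   Formalization: "Full rank" is taken to mean that J has rank D² (full row rank, so θ has at least D² parameters); with fewer parameters and only full column rank, the claim fails, since w then follows a projected gradient. *)

theory Defs
  imports "HOL-Analysis.Analysis"
begin

definition matrix_of_vec :: "real ^ ('d \<times> 'd) \<Rightarrow> real ^ 'd ^ 'd" where
  "matrix_of_vec w = (\<chi> i j. w $ (i, j))"

definition completion_loss ::
    "('d \<times> 'd) set \<Rightarrow> real ^ 'd ^ 'd \<Rightarrow> real ^ 'd ^ 'd \<Rightarrow> real" where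
  "completion_loss \<Omega> \<beta>star \<beta> = 1 / 2 * (\<Sum>(i, j)\<in>\<Omega>. (\<beta> $ i $ j - \<beta>star $ i $ j)\<^sup>2)"

definition direct_loss ::
    "('d \<times> 'd) set \<Rightarrow> real ^ 'd ^ 'd \<Rightarrow> real ^ ('d \<times> 'd) \<Rightarrow> real" where
  "direct_loss \<Omega> \<beta>star w = completion_loss \<Omega> \<beta>star (matrix_of_vec w)"

text \<open>The following is meaningful only where the function is differentiable; there the
  gradient is unique.\<close>

definition gradient :: "('a :: real_inner \<Rightarrow> real) \<Rightarrow> 'a \<Rightarrow> 'a" where
  "gradient f x = (THE g. GDERIV f x :> g)"

text \<open>Class \<open>C\<^sup>k\<close> on an open set, through iterated directional derivatives.\<close>

primrec Ck_on ::
    "nat \<Rightarrow> ('a :: real_normed_vector \<Rightarrow> 'b :: real_normed_vector) \<Rightarrow> 'a set \<Rightarrow> bool" where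
  "Ck_on 0 f U \<longleftrightarrow> continuous_on U f"
| "Ck_on (Suc k) f U \<longleftrightarrow>
     (\<forall>x\<in>U. f differentiable (at x)) \<and>
     (\<forall>v. Ck_on k (\<lambda>x. frechet_derivative f (at x) v) U)"

definition smooth_on ::
    "'a set \<Rightarrow> ('a :: real_normed_vector \<Rightarrow> 'b :: real_normed_vector) \<Rightarrow> bool" where
  "smooth_on U f \<longleftrightarrow> (\<forall>k. Ck_on k f U)"

text \<open>An isotropic Gaussian observation model with mean \<open>w\<close> and constant variance \<open>\<sigma>\<^sup>2\<close> has
  Fisher information \<open>mat (1 / \<sigma>\<^sup>2)\<close> and log loss \<open>1 / \<sigma>\<^sup>2\<close> times the squared error. The common
  factor cancels in natural gradient flow, so it is normalised to 1 in both.\<close>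

definition direct_fisher :: "real ^ 'n \<Rightarrow> real ^ 'n ^ 'n" where
  "direct_fisher w = mat 1"

definition fisher ::
    "(real ^ 'p \<Rightarrow> real ^ 'n) \<Rightarrow> real ^ 'p \<Rightarrow> real ^ 'p ^ 'p" where
  "fisher P \<theta> =
     transpose (jacobian P (at \<theta>)) ** direct_fisher (P \<theta>) ** jacobian P (at \<theta>)"

text \<open>Flows are considered on a set \<open>T\<close> of times (an interval in applications), with one-sided
  derivatives at endpoints belonging to \<open>T\<close>. Since \<open>fisher P \<theta>\<close> may be singular, natural gradient
  flow is an implicit equation for the velocity.\<close>

definition natural_gradient_flow ::
    "(real ^ 'p \<Rightarrow> real ^ 'n) \<Rightarrow> (real ^ 'n \<Rightarrow> real) \<Rightarrow> real set \<Rightarrow> (real \<Rightarrow> real ^ 'p) \<Rightarrow> bool"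
  where
  "natural_gradient_flow P L T \<theta> \<longleftrightarrow>
     (\<forall>t\<in>T. \<exists>v. (\<theta> has_vector_derivative v) (at t within T) \<and>
        fisher P (\<theta> t) *v v = - gradient (L \<circ> P) (\<theta> t))"

definition euclidean_gradient_flow ::
    "('a :: real_inner \<Rightarrow> real) \<Rightarrow> real set \<Rightarrow> (real \<Rightarrow> 'a) \<Rightarrow> bool" where
  "euclidean_gradient_flow L T w \<longleftrightarrow>
     (\<forall>t\<in>T. (w has_vector_derivative - gradient L (w t)) (at t within T))"

end

(* Write J for the Jacobian of P and g for the gradient of the loss. By the chain rule the gradient
   of the composed loss is J^T g, so the flow equation reads J^T (J v) = J^T (-g). Full rank of J
   makes J^T injective, hence J v = -g, and J v is the velocity of P along the trajectory. *)

theory Submission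
  imports Defs
begin

text \<open>The definite description is well defined because Frechet derivatives at a point are
  unique and a vector is determined by its inner products with all \<open>h\<close>.\<close>

lemma gradient_eqI:
  assumes "GDERIV f x :> g"
  shows "gradient f x = g"
  unfolding gradient_def
proof (rule the_equality)
  show "GDERIV f x :> g" by (fact assms)
next
  fix g'
  assume "GDERIV f x :> g'"
  then have "(\<lambda>h. h \<bullet> g') = (\<lambda>h. h \<bullet> g)"
    using assms unfolding gderiv_def by (rule has_derivative_unique)
  then show "g' = g"
    by (simp only: fun_eq_iff vector_eq_ldot)
qed

lemma differentiable_GDERIV_gradient:
  fixes f :: "'a::euclidean_space \<Rightarrow> real"
  assumes "f differentiable (at x)"
  shows "GDERIV f x :> gradient f x"
proof -
  obtain D where D: "(f has_derivative D) (at x)"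
    using assms unfolding differentiable_def by blast
  \<comment> \<open>Riesz representation in finite dimension: the adjoint of the functional
    \<open>D\<close> maps a real \<open>c\<close> to \<open>c\<close> times the representing vector,
    so \<open>c = 1\<close> yields that vector.\<close>
  have "D h = h \<bullet> adjoint D 1" for h
    using adjoint_works[OF has_derivative_linear[OF D], of h 1] by simp
  then have "D = (\<lambda>h. h \<bullet> adjoint D 1)"
    by (rule ext)
  with D have "GDERIV f x :> adjoint D 1"
    unfolding gderiv_def by (rule subst[rotated])
  then show ?thesis
    by (simp add: gradient_eqI)
qed

lemma gradient_compose:
  fixes f :: "real ^ 'n \<Rightarrow> real" and P :: "real ^ 'p \<Rightarrow> real ^ 'n"
  assumes "P differentiable (at x)" and "f differentiable (at (P x))"
  shows "gradient (f \<circ> P) x = transpose (jacobian P (at x)) *v gradient f (P x)"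
proof (rule gradient_eqI)
  have "(P has_derivative (\<lambda>h. jacobian P (at x) *v h)) (at x)"
    using assms(1) by (simp add: jacobian_works)
  moreover have "(f has_derivative (\<lambda>h. h \<bullet> gradient f (P x))) (at (P x))"
    using differentiable_GDERIV_gradient[OF assms(2)] unfolding gderiv_def .
  ultimately have "(f \<circ> P has_derivative
      (\<lambda>h. h \<bullet> gradient f (P x)) \<circ> (\<lambda>h. jacobian P (at x) *v h)) (at x)"
    by (rule diff_chain_at)
  moreover have "(\<lambda>h. h \<bullet> gradient f (P x)) \<circ> (\<lambda>h. jacobian P (at x) *v h)
      = (\<lambda>h. h \<bullet> (transpose (jacobian P (at x)) *v gradient f (P x)))"
  proof
    fix h
    \<comment> \<open>The chain rule has produced the functional pairing \<open>J h\<close> with the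
      gradient of \<open>f\<close>; moving \<open>J\<close> to the other side of the inner product
      exposes the representing vector.\<close>
    have "gradient f (P x) \<bullet> (jacobian P (at x) *v h)
        = (transpose (jacobian P (at x)) *v gradient f (P x)) \<bullet> h"
      by (simp add: dot_lmul_matrix)
    then show "((\<lambda>h. h \<bullet> gradient f (P x)) \<circ> (\<lambda>h. jacobian P (at x) *v h)) h
        = h \<bullet> (transpose (jacobian P (at x)) *v gradient f (P x))"
      unfolding comp_apply by (subst (1 2) inner_commute)
  qed
  ultimately show "GDERIV (f \<circ> P) x :> transpose (jacobian P (at x)) *v gradient f (P x)"
    unfolding gderiv_def by simp
qed

text \<open>Transposition preserves rank, and a matrix is injective iff its rank equals its number
  of columns, which for \<open>transpose A\<close> is \<open>CARD('n)\<close>.\<close>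

lemma transpose_inj_if_full_row_rank:
  fixes A :: "real ^ 'p ^ 'n"
  assumes "rank A = CARD('n)"
  shows "inj ((*v) (transpose A))"
  using assms by (simp only: rank_transpose flip: full_rank_injective)

lemma direct_loss_differentiable:
  "direct_loss \<Omega> \<beta>star differentiable (at w)"
proof -
  \<comment> \<open>Indexing by the pair \<open>p\<close> shows the loss as a quadratic polynomial
    in the coordinates of \<open>w\<close>.\<close>
  have "(\<lambda>w. 1 / 2 * (\<Sum>p\<in>\<Omega>. (w $ p - \<beta>star $ fst p $ snd p)\<^sup>2)) differentiable (at w)"
    by (intro differentiable_mult differentiable_const differentiable_sum differentiable_power
        differentiable_diff bounded_linear_imp_differentiable bounded_linear_vec_nth finite ballI)
  then show ?thesis
    by (simp add: direct_loss_def[abs_def] completion_loss_def matrix_of_vec_def case_prod_beta)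
qed

text \<open>The argument is pointwise in \<open>t\<close>. If \<open>'p\<close> has more elements
  than \<open>'n\<close>, then \<open>fisher\<close> is singular and the flow equation does not
  determine \<open>v\<close>, but it still determines \<open>J *v v\<close>.\<close>

lemma natural_gradient_flow_imp_euclidean_gradient_flow:
  fixes P :: "real ^ 'p \<Rightarrow> real ^ 'n"
  assumes flow: "natural_gradient_flow P L T \<theta>"
    and P: "\<And>t. t \<in> T \<Longrightarrow> P differentiable (at (\<theta> t))"
    and L: "\<And>t. t \<in> T \<Longrightarrow> L differentiable (at (P (\<theta> t)))"
    and rank: "\<And>t. t \<in> T \<Longrightarrow> rank (jacobian P (at (\<theta> t))) = CARD('n)"
  shows "euclidean_gradient_flow L T (\<lambda>t. P (\<theta> t))"
  unfolding euclidean_gradient_flow_def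
proof
  fix t assume t: "t \<in> T"
  define J where "J = jacobian P (at (\<theta> t))"
  define g where "g = gradient L (P (\<theta> t))"
  obtain v where v: "(\<theta> has_vector_derivative v) (at t within T)"
    and eq: "fisher P (\<theta> t) *v v = - gradient (L \<circ> P) (\<theta> t)"
    using flow t unfolding natural_gradient_flow_def by blast
  have "fisher P (\<theta> t) *v v = transpose J *v (J *v v)"
    by (simp add: fisher_def direct_fisher_def J_def matrix_vector_mul_assoc)
  moreover have "- gradient (L \<circ> P) (\<theta> t) = transpose J *v (- g)"
    using gradient_compose[OF P[OF t] L[OF t]]
    by (simp add: J_def g_def vec.neg)
  ultimately have "transpose J *v (J *v v) = transpose J *v (- g)"
    using eq by simp
  moreover have "inj ((*v) (transpose J))"
    unfolding J_def by (rule transpose_inj_if_full_row_rank[OF rank[OF t]])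
  ultimately have Jv: "J *v v = - g"
    by (rule injD[rotated])
  \<comment> \<open>Restricting to the image of \<open>T\<close> is the form that the chain rule for
    derivatives within \<open>T\<close> takes, which covers one-sided derivatives at
    endpoints.\<close>
  have "(P has_derivative (\<lambda>h. J *v h)) (at (\<theta> t) within \<theta> ` T)"
    using P[OF t] by (auto simp: J_def jacobian_works intro: has_derivative_at_withinI)
  then have "(P \<circ> \<theta> has_vector_derivative J *v v) (at t within T)"
    using vector_derivative_diff_chain_within[OF v] by blast
  then show "((\<lambda>t. P (\<theta> t)) has_vector_derivative - gradient L (P (\<theta> t))) (at t within T)"
    by (simp add: comp_def Jv g_def)
qed

theorem mainTheorem5:
  fixes \<Omega> :: "('d::finite \<times> 'd) set"
    and \<beta>star :: "real ^ 'd ^ 'd"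
    and P :: "real ^ 'p::finite \<Rightarrow> real ^ ('d \<times> 'd)"
    and U :: "(real ^ 'p) set"
    and \<theta> :: "real \<Rightarrow> real ^ 'p"
    and T :: "real set"
  assumes "open U"
    and "smooth_on U P"
    and "is_interval T"
    and "\<And>t. t \<in> T \<Longrightarrow> \<theta> t \<in> U"
    and "natural_gradient_flow P (direct_loss \<Omega> \<beta>star) T \<theta>"
    and "\<And>t. t \<in> T \<Longrightarrow> rank (jacobian P (at (\<theta> t))) = CARD('d \<times> 'd)"
  shows "euclidean_gradient_flow (direct_loss \<Omega> \<beta>star) T (\<lambda>t. P (\<theta> t))"
proof (rule natural_gradient_flow_imp_euclidean_gradient_flow
    [OF assms(5) _ direct_loss_differentiable assms(6)])
  fix t assume t: "t \<in> T"
  \<comment> \<open>First-order smoothness gives differentiability at each point of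
    \<open>U\<close>, where the trajectory stays.\<close>
  have "Ck_on (Suc 0) P U"
    using assms(2) unfolding smooth_on_def by blast
  then show "P differentiable (at (\<theta> t))"
    using assms(4)[OF t] by simp
qed

end
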